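(* Let $g,h\in\mathrm S(\mathbb R)$ be symmetric homeomorphisms of $\mathbb R$ and suppose that $h^{-1}$ is uniformly continuous on $\mathbb R$. Then $g\circ h^{-1}\in\mathrm S(\mathbb R)$.
   Context: An increasing homeomorphism $h$ of $\mathbb R$ onto itself is quasisymmetric if there is $M\ge1$ with $\frac1M\le\frac{h(x+t)-h(x)}{h(x)-h(x-t)}\le M$ for all $x\in\mathbb R$, $t>0$. A quasisymmetric homeomorphism $h$ is symmetric if $\lim_{t\to0}\frac{h(x+t)-h(x)}{h(x)-h(x-t)}=1$ uniformly for all $x\in\mathbb R$. $\mathrm S(\mathbb R)$ denotes the set of all symmetric homeomorphisms of $\mathbb R$. *)

theory Defs
  imports "HOL-Analysis.Analysis"
begin

definition increasing_homeo :: "(real \<Rightarrow> real) \<Rightarrow> bool" where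
  "increasing_homeo h \<longleftrightarrow> strict_mono h \<and> (\<exists>k. homeomorphism UNIV UNIV h k)"

definition qs_ratio :: "(real \<Rightarrow> real) \<Rightarrow> real \<Rightarrow> real \<Rightarrow> real" where
  "qs_ratio h x t = (h (x + t) - h x) / (h x - h (x - t))"

definition quasisymmetric :: "(real \<Rightarrow> real) \<Rightarrow> bool" where
  "quasisymmetric h \<longleftrightarrow> increasing_homeo h \<and>
     (\<exists>M\<ge>1. \<forall>x. \<forall>t>0. 1 / M \<le> qs_ratio h x t \<and> qs_ratio h x t \<le> M)"

(* The limit is two-sided. Since qs_ratio h x (- t) = 1 / qs_ratio h x t, restricting it to
   t > 0 would give the same notion. *)
definition symmetric_homeos :: "(real \<Rightarrow> real) set" where
  "symmetric_homeos =
     {h. quasisymmetric h \<and> uniform_limit UNIV (\<lambda>t x. qs_ratio h x t) (\<lambda>x. 1) (at 0)}"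

end

theory Submission
  imports Defs
begin

text \<open>
  Put $x = h^{-1}(y)$, $a = h^{-1}(y+t) - x$ and $b = x - h^{-1}(y-t)$, so that $h$ increases by the
  same amount $t$ on $[x-b,x]$ and on $[x,x+a]$. Comparing $[x,x+b]$ with $[x-b,x]$, the symmetry of
  $h$ at scale $b$ shows that $h([x+b,x+a])$ is a small part of $h([x,x+a])$ when $a > b$. Iterated
  doubling converts this, via the quasisymmetry of $h$, into the smallness of $a-b$ relative to $a$,
  and then, via the quasisymmetry of $g$, into the smallness of $g([x+b,x+a])$ relative to
  $g([x,x+a])$. The symmetry of $g$ at scale $b$ finishes the estimate. Uniform continuity of
  $h^{-1}$ is what makes $b$ small uniformly in $y$.
\<close>

section \<open>Quasisymmetry and symmetry as inequalities between absolute increments\<close>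

text \<open>By monotonicity the numerator and denominator never have opposite signs, so absolute
  values can be inserted for either sign of \<open>t\<close>.\<close>

lemma qs_ratio_abs:
  assumes "strict_mono h"
  shows "qs_ratio h x t = \<bar>h (x + t) - h x\<bar> / \<bar>h x - h (x - t)\<bar>"
proof (cases "t \<ge> 0")
  case True
  then have "h x \<le> h (x + t)" "h (x - t) \<le> h x"
    using strict_mono_less_eq[OF assms] by auto
  then show ?thesis by (simp add: qs_ratio_def)
next
  case False
  then have "h (x + t) \<le> h x" "h x \<le> h (x - t)"
    using strict_mono_less_eq[OF assms] by auto
  then show ?thesis
    using minus_divide_divide[of "h (x + t) - h x" "h x - h (x - t)"] by (simp add: qs_ratio_def)
qed

lemma increment_pos:
  fixes h :: "real \<Rightarrow> real"
  assumes "strict_mono h" "t \<noteq> 0"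
  shows "0 < \<bar>h x - h (x - t)\<bar>" "0 < \<bar>h (x + t) - h x\<bar>"
  using strict_mono_eq[OF assms(1), of x "x - t"] strict_mono_eq[OF assms(1), of "x + t" x] assms(2)
  by auto

lemma qs_ratio_le_iff:
  assumes "strict_mono h" "t \<noteq> 0"
  shows "qs_ratio h x t \<le> M \<longleftrightarrow> \<bar>h (x + t) - h x\<bar> \<le> M * \<bar>h x - h (x - t)\<bar>"
  using increment_pos(1)[OF assms] by (simp add: qs_ratio_abs[OF assms(1)] pos_divide_le_eq)

text \<open>The right-hand side is the inequality of \<open>qs_ratio_le_iff\<close> with
  \<open>- t\<close> in place of \<open>t\<close>: a lower bound at \<open>t\<close> is an upper
  bound at \<open>- t\<close>.\<close>

lemma le_qs_ratio_iff:
  assumes "strict_mono h" "t \<noteq> 0" "M > 0"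
  shows "1 / M \<le> qs_ratio h x t \<longleftrightarrow> \<bar>h (x - t) - h x\<bar> \<le> M * \<bar>h x - h (x + t)\<bar>"
  using increment_pos[OF assms(1,2), of x] assms(3)
  by (simp add: qs_ratio_abs[OF assms(1)] divide_simps abs_minus_commute mult.commute)

text \<open>Letting \<open>t\<close> take both signs makes the lower bound on the ratio redundant.\<close>

lemma quasisymmetric_iff:
  "quasisymmetric h \<longleftrightarrow> increasing_homeo h \<and>
     (\<exists>M\<ge>1. \<forall>x t. \<bar>h (x + t) - h x\<bar> \<le> M * \<bar>h x - h (x - t)\<bar>)"
proof -
  have "(\<forall>x. \<forall>t>0. 1 / M \<le> qs_ratio h x t \<and> qs_ratio h x t \<le> M) \<longleftrightarrow>
        (\<forall>x t. \<bar>h (x + t) - h x\<bar> \<le> M * \<bar>h x - h (x - t)\<bar>)" (is "?L \<longleftrightarrow> ?R")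
    if h: "strict_mono h" and M: "M \<ge> 1" for M
  proof
    assume L: ?L
    show ?R
    proof (intro allI)
      fix x t :: real
      consider "t = 0" | "t > 0" | "t < 0" by linarith
      then show "\<bar>h (x + t) - h x\<bar> \<le> M * \<bar>h x - h (x - t)\<bar>"
      proof cases
        case 2
        then show ?thesis using L qs_ratio_le_iff[OF h] by simp
      next
        case 3
        then show ?thesis using L[rule_format, of "- t" x] le_qs_ratio_iff[OF h, of "- t" M x] M by simp
      qed simp
    qed
  next
    assume R: ?R
    show ?L
    proof (intro allI impI)
      fix x t :: real
      assume "t > 0"
      then show "1 / M \<le> qs_ratio h x t \<and> qs_ratio h x t \<le> M"
        using R[rule_format, of x t] R[rule_format, of x "- t"] M
        by (simp add: qs_ratio_le_iff[OF h] le_qs_ratio_iff[OF h])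
    qed
  qed
  then show ?thesis
    unfolding quasisymmetric_def increasing_homeo_def by blast
qed

text \<open>The upper bound at \<open>- t\<close> yields the lower bound \<open>1 / (1 + e)\<close>
  for the ratio at \<open>t\<close>. At \<open>t = 0\<close> both sides of the inequality vanish, so
  the punctured neighbourhood may be filled in.\<close>

lemma uniform_limit_qs_ratio_iff:
  assumes h: "strict_mono h"
  shows "uniform_limit UNIV (\<lambda>t x. qs_ratio h x t) (\<lambda>x. 1) (at 0) \<longleftrightarrow>
    (\<forall>e>0. \<exists>d>0. \<forall>x t. \<bar>t\<bar> < d \<longrightarrow> \<bar>h (x + t) - h x\<bar> \<le> (1 + e) * \<bar>h x - h (x - t)\<bar>)"
    (is "?L \<longleftrightarrow> ?R")
proof
  assume L: ?L
  show ?R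
  proof (intro allI impI)
    fix e :: real
    assume "e > 0"
    then obtain d where d: "d > 0"
      "\<And>t x. t \<noteq> 0 \<Longrightarrow> \<bar>t\<bar> < d \<Longrightarrow> \<bar>qs_ratio h x t - 1\<bar> < e"
      using L unfolding uniform_limit_iff eventually_at by (auto simp: dist_real_def)
    have "\<bar>h (x + t) - h x\<bar> \<le> (1 + e) * \<bar>h x - h (x - t)\<bar>" if "\<bar>t\<bar> < d" for x t
    proof (cases "t = 0")
      case False
      then have "qs_ratio h x t \<le> 1 + e" using d(2)[OF False that, of x] by linarith
      then show ?thesis using qs_ratio_le_iff[OF h False] by blast
    qed simp
    then show "\<exists>d>0. \<forall>x t. \<bar>t\<bar> < d \<longrightarrow> \<bar>h (x + t) - h x\<bar> \<le> (1 + e) * \<bar>h x - h (x - t)\<bar>"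
      using d(1) by blast
  qed
next
  assume R: ?R
  show ?L
    unfolding uniform_limit_iff
  proof (intro allI impI)
    fix e :: real
    assume "e > 0"
    \<comment> \<open>Half of \<open>e\<close> turns the weak bounds \<open>1 - e / 2\<close> and
      \<open>1 + e / 2\<close> on the ratio into the strict \<open>dist\<close> bound.\<close>
    then have "e / 2 > 0" by simp
    then obtain d where d: "d > 0"
      "\<And>x t. \<bar>t\<bar> < d \<Longrightarrow> \<bar>h (x + t) - h x\<bar> \<le> (1 + e / 2) * \<bar>h x - h (x - t)\<bar>"
      using R by blast
    have "dist (qs_ratio h x t) 1 < e" if t: "t \<noteq> 0" "\<bar>t\<bar> < d" for x t
    proof -
      have "qs_ratio h x t \<le> 1 + e / 2"
        using d(2)[OF t(2)] qs_ratio_le_iff[OF h t(1)] by blast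
      moreover have "1 / (1 + e / 2) \<le> qs_ratio h x t"
        using d(2)[of "- t" x] t le_qs_ratio_iff[OF h t(1), of "1 + e / 2" x] \<open>e > 0\<close> by simp
      moreover have "1 - e / 2 \<le> 1 / (1 + e / 2)"
        using \<open>e > 0\<close> by (simp add: field_simps)
      ultimately show ?thesis using \<open>e > 0\<close> by (auto simp: dist_real_def)
    qed
    then show "\<forall>\<^sub>F t in at 0. \<forall>x\<in>UNIV. dist (qs_ratio h x t) 1 < e"
      unfolding eventually_at using d(1) by (auto simp: dist_real_def)
  qed
qed

lemma symmetric_homeos_iff:
  "h \<in> symmetric_homeos \<longleftrightarrow> increasing_homeo h \<and>
     (\<exists>M\<ge>1. \<forall>x t. \<bar>h (x + t) - h x\<bar> \<le> M * \<bar>h x - h (x - t)\<bar>) \<and>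
     (\<forall>e>0. \<exists>d>0. \<forall>x t. \<bar>t\<bar> < d \<longrightarrow> \<bar>h (x + t) - h x\<bar> \<le> (1 + e) * \<bar>h x - h (x - t)\<bar>)"
  unfolding symmetric_homeos_def quasisymmetric_iff
  using uniform_limit_qs_ratio_iff by (auto simp: increasing_homeo_def)

section \<open>Increments of monotone functions, doubling and halving\<close>

text \<open>Displacements are signed, so that one argument covers both sides of a base point. This
  turns a comparison of sizes into the nesting condition of \<open>increment_mono\<close> and
  \<open>increment_split\<close>.\<close>

lemma between_if_abs_le:
  fixes s t :: real
  assumes "0 \<le> s * t" "\<bar>s\<bar> \<le> \<bar>t\<bar>"
  shows "0 \<le> s \<and> s \<le> t \<or> t \<le> s \<and> s \<le> 0"
  using assms by (auto simp: zero_le_mult_iff)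

lemma increment_mono:
  fixes h :: "real \<Rightarrow> real"
  assumes "mono h" "0 \<le> s \<and> s \<le> t \<or> t \<le> s \<and> s \<le> 0"
  shows "\<bar>h (x + s) - h x\<bar> \<le> \<bar>h (x + t) - h x\<bar>"
  using assms(2)
proof
  assume "0 \<le> s \<and> s \<le> t"
  then have "h x \<le> h (x + s)" "h (x + s) \<le> h (x + t)" by (auto intro: monoD[OF assms(1)])
  then show ?thesis by linarith
next
  assume "t \<le> s \<and> s \<le> 0"
  then have "h (x + s) \<le> h x" "h (x + t) \<le> h (x + s)" by (auto intro: monoD[OF assms(1)])
  then show ?thesis by linarith
qed

lemma increment_split:
  fixes h :: "real \<Rightarrow> real"
  assumes "mono h" "0 \<le> s \<and> s \<le> t \<or> t \<le> s \<and> s \<le> 0"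
  shows "\<bar>h (x + t) - h x\<bar> = \<bar>h (x + s) - h x\<bar> + \<bar>h (x + t) - h (x + s)\<bar>"
  using assms(2)
proof
  assume "0 \<le> s \<and> s \<le> t"
  then have "h x \<le> h (x + s)" "h (x + s) \<le> h (x + t)" by (auto intro: monoD[OF assms(1)])
  then show ?thesis by linarith
next
  assume "t \<le> s \<and> s \<le> 0"
  then have "h (x + s) \<le> h x" "h (x + t) \<le> h (x + s)" by (auto intro: monoD[OF assms(1)])
  then show ?thesis by linarith
qed

text \<open>The increment over the outer half of a doubled interval is at most \<open>M\<close>
  times that over the inner half, so each doubling costs a factor \<open>1 + M\<close>.\<close>

lemma increment_doubling:
  fixes h :: "real \<Rightarrow> real"
  assumes M: "M \<ge> 0" "\<And>x t. \<bar>h (x + t) - h x\<bar> \<le> M * \<bar>h x - h (x - t)\<bar>"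
  shows "\<bar>h (x + 2 ^ k * s) - h x\<bar> \<le> (1 + M) ^ k * \<bar>h (x + s) - h x\<bar>"
proof (induction k)
  case (Suc k)
  let ?s = "2 ^ k * s"
  have "\<bar>h (x + 2 * ?s) - h (x + ?s)\<bar> \<le> M * \<bar>h (x + ?s) - h x\<bar>"
    using M(2)[of "x + ?s" ?s] by (simp add: algebra_simps)
  then have "\<bar>h (x + 2 * ?s) - h x\<bar> \<le> (1 + M) * \<bar>h (x + ?s) - h x\<bar>"
    by (simp add: algebra_simps)
  also have "\<dots> \<le> (1 + M) * ((1 + M) ^ k * \<bar>h (x + s) - h x\<bar>)"
    using Suc M(1) by (intro mult_left_mono) auto
  finally show ?case by (simp add: mult.assoc)
qed simp

text \<open>The bound at the midpoint with a negative step gives inner half \<le> \<open>M\<close>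
  times outer half. The inner half thus carries at most the fraction \<open>M / (1 + M)\<close> of
  the whole, and this fraction is below 1, so iteration gives geometric decay.\<close>

lemma increment_halving:
  fixes h :: "real \<Rightarrow> real"
  assumes "mono h" and M: "M \<ge> 0" "\<And>x t. \<bar>h (x + t) - h x\<bar> \<le> M * \<bar>h x - h (x - t)\<bar>"
  shows "\<bar>h (x + s) - h x\<bar> \<le> (M / (1 + M)) ^ k * \<bar>h (x + 2 ^ k * s) - h x\<bar>"
proof (induction k)
  case (Suc k)
  let ?s = "2 ^ k * s"
  have sgn: "0 \<le> ?s \<and> ?s \<le> 2 * ?s \<or> 2 * ?s \<le> ?s \<and> ?s \<le> 0" by linarith
  have "\<bar>h x - h (x + ?s)\<bar> \<le> M * \<bar>h (x + ?s) - h (x + 2 * ?s)\<bar>"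
    using M(2)[of "x + ?s" "- ?s"] by (simp add: algebra_simps)
  then have "(1 + M) * \<bar>h (x + ?s) - h x\<bar> \<le> M * \<bar>h (x + 2 * ?s) - h x\<bar>"
    unfolding increment_split[OF \<open>mono h\<close> sgn, of x] by (simp add: algebra_simps abs_minus_commute)
  then have "\<bar>h (x + ?s) - h x\<bar> \<le> M / (1 + M) * \<bar>h (x + 2 * ?s) - h x\<bar>"
    using M(1) by (simp add: field_simps)
  then have "(M / (1 + M)) ^ k * \<bar>h (x + ?s) - h x\<bar>
      \<le> (M / (1 + M)) ^ k * (M / (1 + M) * \<bar>h (x + 2 * ?s) - h x\<bar>)"
    using M(1) by (intro mult_left_mono) auto
  with Suc show ?case by (simp add: mult_ac)
qed simp

section \<open>Transfer of increment estimates from \<open>h\<close> to \<open>g\<close>\<close>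

text \<open>Equal \<open>h\<close>-increments on the two sides of \<open>x\<close> force
  \<open>a\<close> to be at most a fixed multiple \<open>2 ^ k\<close> of \<open>b\<close> in size,
  by halving for \<open>h\<close>. Doubling for \<open>g\<close> then bounds the
  \<open>g\<close>-increments. This yields the quasisymmetry of the composition.\<close>

lemma increment_comparison:
  fixes g h :: "real \<Rightarrow> real"
  assumes "strict_mono g" "strict_mono h"
    and Mg: "Mg \<ge> 1" "\<And>x t. \<bar>g (x + t) - g x\<bar> \<le> Mg * \<bar>g x - g (x - t)\<bar>"
    and Mh: "Mh \<ge> 1" "\<And>x t. \<bar>h (x + t) - h x\<bar> \<le> Mh * \<bar>h x - h (x - t)\<bar>"
  obtains M where "M \<ge> 1"
    "\<And>x a b. 0 \<le> a * b \<Longrightarrow> \<bar>h (x + a) - h x\<bar> = \<bar>h x - h (x - b)\<bar> \<Longrightarrow>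
       \<bar>g (x + a) - g x\<bar> \<le> M * \<bar>g x - g (x - b)\<bar>"
proof -
  note mono = assms(1,2)[THEN strict_mono_mono]
  have "Mh / (1 + Mh) < 1" using Mh by (simp add: field_simps)
  then obtain k where k: "(Mh / (1 + Mh)) ^ k < 1 / Mh"
    using real_arch_pow_inv[of "1 / Mh" "Mh / (1 + Mh)"] Mh by auto
  show thesis
  \<comment> \<open>The power pays for \<open>k\<close> doublings from \<open>b\<close> to
    \<open>2 ^ k * b\<close>, the last factor for reflecting \<open>[x, x + b]\<close> to
    \<open>[x - b, x]\<close>.\<close>
  proof (rule that[of "(1 + Mg) ^ k * Mg"])
    have "1 * 1 \<le> (1 + Mg) ^ k * Mg" using Mg by (intro mult_mono one_le_power) auto
    then show "1 \<le> (1 + Mg) ^ k * Mg" by simp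
  next
    fix x a b :: real
    assume sgn: "0 \<le> a * b" and eq: "\<bar>h (x + a) - h x\<bar> = \<bar>h x - h (x - b)\<bar>"
    show "\<bar>g (x + a) - g x\<bar> \<le> (1 + Mg) ^ k * Mg * \<bar>g x - g (x - b)\<bar>"
    proof (cases "a = 0")
      case True
      then show ?thesis using Mg by simp
    next
      case False
      have pos: "0 < \<bar>h (x + a) - h x\<bar>"
        using False by (rule increment_pos[OF assms(2)])
      have le: "\<bar>a\<bar> \<le> \<bar>2 ^ k * b\<bar>"
      \<comment> \<open>Otherwise \<open>x + 2 ^ k * b\<close> lies between \<open>x\<close> and
        \<open>x + a\<close>. Reflection and halving then bound the \<open>h\<close>-increment over
        \<open>a\<close> by \<open>Mh * (Mh / (1 + Mh)) ^ k < 1\<close> times itself.\<close>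
      proof (rule ccontr)
        assume "\<not> ?thesis"
        moreover have "0 \<le> a * (2 ^ k * b)"
          using mult_nonneg_nonneg[OF sgn, of "2 ^ k"] by (simp add: mult_ac)
        ultimately have "0 \<le> 2 ^ k * b \<and> 2 ^ k * b \<le> a \<or> a \<le> 2 ^ k * b \<and> 2 ^ k * b \<le> 0"
          by (intro between_if_abs_le) (auto simp: mult.commute)
        then have ia: "\<bar>h (x + 2 ^ k * b) - h x\<bar> \<le> \<bar>h (x + a) - h x\<bar>"
          by (rule increment_mono[OF mono(2)])
        have "\<bar>h (x + a) - h x\<bar> \<le> Mh * \<bar>h (x + b) - h x\<bar>"
          using Mh(2)[of x "- b"] eq by (simp add: abs_minus_commute)
        also have "\<dots> \<le> Mh * ((Mh / (1 + Mh)) ^ k * \<bar>h (x + 2 ^ k * b) - h x\<bar>)"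
          using Mh by (intro mult_left_mono increment_halving mono) auto
        also have "\<dots> \<le> Mh * ((Mh / (1 + Mh)) ^ k * \<bar>h (x + a) - h x\<bar>)"
          using Mh ia by (intro mult_left_mono) auto
        also have "\<dots> < Mh * (1 / Mh * \<bar>h (x + a) - h x\<bar>)"
          using Mh k pos by (intro mult_strict_left_mono mult_strict_right_mono) auto
        finally show False using Mh by simp
      qed
      have "0 \<le> a * (2 ^ k * b)"
        using mult_nonneg_nonneg[OF sgn, of "2 ^ k"] by (simp add: mult_ac)
      then have "0 \<le> a \<and> a \<le> 2 ^ k * b \<or> 2 ^ k * b \<le> a \<and> a \<le> 0"
        using le by (rule between_if_abs_le)
      then have "\<bar>g (x + a) - g x\<bar> \<le> \<bar>g (x + 2 ^ k * b) - g x\<bar>"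
        by (rule increment_mono[OF mono(1)])
      also have "\<dots> \<le> (1 + Mg) ^ k * \<bar>g (x + b) - g x\<bar>"
        using Mg by (intro increment_doubling) auto
      also have "\<dots> \<le> (1 + Mg) ^ k * (Mg * \<bar>g x - g (x - b)\<bar>)"
        using Mg by (intro mult_left_mono) auto
      finally show ?thesis by (simp add: mult.assoc)
    qed
  qed
qed

text \<open>A relatively small \<open>h\<close>-increment forces \<open>d\<close> to be at most
  \<open>c / 2 ^ k\<close> in size, by doubling for \<open>h\<close>. Halving for \<open>g\<close>
  then makes the \<open>g\<close>-increment relatively small, with \<open>k\<close> determined by
  \<open>e\<close>.\<close>

lemma small_increment_transfer:
  fixes g h :: "real \<Rightarrow> real"
  assumes "strict_mono g" "strict_mono h"
    and Mg: "Mg \<ge> 1" "\<And>x t. \<bar>g (x + t) - g x\<bar> \<le> Mg * \<bar>g x - g (x - t)\<bar>"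
    and Mh: "Mh \<ge> 1" "\<And>x t. \<bar>h (x + t) - h x\<bar> \<le> Mh * \<bar>h x - h (x - t)\<bar>"
    and "e > 0"
  obtains n where "n > 0"
    "\<And>z c d. 0 \<le> c * d \<Longrightarrow> \<bar>h (z + d) - h z\<bar> \<le> n * \<bar>h (z + c) - h z\<bar> \<Longrightarrow>
       \<bar>g (z + d) - g z\<bar> \<le> e * \<bar>g (z + c) - g z\<bar>"
proof -
  note mono = assms(1,2)[THEN strict_mono_mono]
  have "Mg / (1 + Mg) < 1" using Mg by (simp add: field_simps)
  then obtain k where k: "(Mg / (1 + Mg)) ^ k < e"
    using real_arch_pow_inv[of e "Mg / (1 + Mg)"] \<open>e > 0\<close> by auto
  show thesis
  \<comment> \<open>The extra factor 2 makes the contradiction below strict: a positive increment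
    would be at most half of itself.\<close>
  proof (rule that[of "1 / (2 * (1 + Mh) ^ k)"])
    show "0 < 1 / (2 * (1 + Mh) ^ k)" using Mh by simp
  next
    fix z c d :: real
    assume sgn: "0 \<le> c * d"
      and small: "\<bar>h (z + d) - h z\<bar> \<le> 1 / (2 * (1 + Mh) ^ k) * \<bar>h (z + c) - h z\<bar>"
    have sgn': "0 \<le> c * (2 ^ k * d)"
      using mult_nonneg_nonneg[OF sgn, of "2 ^ k"] by (simp add: mult_ac)
    show "\<bar>g (z + d) - g z\<bar> \<le> e * \<bar>g (z + c) - g z\<bar>"
    proof (cases "c = 0 \<or> d = 0")
      case True
      \<comment> \<open>If \<open>c = 0\<close>, the smallness assumption makes the
        \<open>h\<close>-increment over \<open>d\<close> vanish, and strict monotonicity gives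
        \<open>d = 0\<close>.\<close>
      then have "d = 0"
        using small increment_pos(2)[OF assms(2), of d z] by fastforce
      then show ?thesis using \<open>e > 0\<close> by simp
    next
      case False
      have le: "\<bar>2 ^ k * d\<bar> \<le> \<bar>c\<bar>"
      proof (rule ccontr)
        assume "\<not> ?thesis"
        then have "0 \<le> c \<and> c \<le> 2 ^ k * d \<or> 2 ^ k * d \<le> c \<and> c \<le> 0"
          using between_if_abs_le[of c "2 ^ k * d"] sgn' by linarith
        then have "\<bar>h (z + c) - h z\<bar> \<le> \<bar>h (z + 2 ^ k * d) - h z\<bar>"
          by (rule increment_mono[OF mono(2)])
        also have "\<dots> \<le> (1 + Mh) ^ k * \<bar>h (z + d) - h z\<bar>"
          using Mh by (intro increment_doubling) auto
        also have "\<dots> \<le> (1 + Mh) ^ k * (1 / (2 * (1 + Mh) ^ k) * \<bar>h (z + c) - h z\<bar>)"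
          using Mh small by (intro mult_left_mono) auto
        also have "\<dots> = \<bar>h (z + c) - h z\<bar> / 2" using Mh by simp
        finally show False using increment_pos(2)[OF assms(2), of c z] False by simp
      qed
      then have "0 \<le> 2 ^ k * d \<and> 2 ^ k * d \<le> c \<or> c \<le> 2 ^ k * d \<and> 2 ^ k * d \<le> 0"
        using sgn' by (intro between_if_abs_le) (auto simp: mult.commute)
      then have ic: "\<bar>g (z + 2 ^ k * d) - g z\<bar> \<le> \<bar>g (z + c) - g z\<bar>"
        by (rule increment_mono[OF mono(1)])
      have "\<bar>g (z + d) - g z\<bar> \<le> (Mg / (1 + Mg)) ^ k * \<bar>g (z + 2 ^ k * d) - g z\<bar>"
        using Mg by (intro increment_halving mono) auto
      also have "\<dots> \<le> e * \<bar>g (z + c) - g z\<bar>"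
        using k ic \<open>e > 0\<close> by (intro mult_mono) auto
      finally show ?thesis .
    qed
  qed
qed

text \<open>Passing from \<open>x - b\<close> to \<open>x + b\<close> costs a factor near 1 by the
  symmetry of \<open>g\<close>, and passing from \<open>x + b\<close> to \<open>x + a\<close> costs
  another by the symmetry of \<open>h\<close> and \<open>small_increment_transfer\<close>. Only
  \<open>b\<close> has to be small for this.\<close>

lemma increment_comparison_small_scale:
  fixes g h :: "real \<Rightarrow> real"
  assumes "strict_mono g" "strict_mono h"
    and Mg: "Mg \<ge> 1" "\<And>x t. \<bar>g (x + t) - g x\<bar> \<le> Mg * \<bar>g x - g (x - t)\<bar>"
    and Mh: "Mh \<ge> 1" "\<And>x t. \<bar>h (x + t) - h x\<bar> \<le> Mh * \<bar>h x - h (x - t)\<bar>"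
    and Sg: "\<And>e. e > 0 \<Longrightarrow>
      \<exists>d>0. \<forall>x t. \<bar>t\<bar> < d \<longrightarrow> \<bar>g (x + t) - g x\<bar> \<le> (1 + e) * \<bar>g x - g (x - t)\<bar>"
    and Sh: "\<And>e. e > 0 \<Longrightarrow>
      \<exists>d>0. \<forall>x t. \<bar>t\<bar> < d \<longrightarrow> \<bar>h (x + t) - h x\<bar> \<le> (1 + e) * \<bar>h x - h (x - t)\<bar>"
    and "e > 0"
  obtains r where "r > 0"
    "\<And>x a b. 0 \<le> a * b \<Longrightarrow> \<bar>b\<bar> < r \<Longrightarrow> \<bar>h (x + a) - h x\<bar> = \<bar>h x - h (x - b)\<bar> \<Longrightarrow>
       \<bar>g (x + a) - g x\<bar> \<le> (1 + e) * \<bar>g x - g (x - b)\<bar>"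
proof -
  note mono = assms(1,2)[THEN strict_mono_mono]
  \<comment> \<open>Chosen so that \<open>(1 + e') / (1 - e') \<le> 1 + e\<close>, the combined cost
    of the two passages.\<close>
  define e' where "e' = min e 1 / 4"
  have e': "0 < e'" "e' \<le> 1 / 4" "4 * e' \<le> e" using \<open>e > 0\<close> by (auto simp: e'_def)
  have "(1 + e') \<le> (1 - e') * (1 + 4 * e')"
    using mult_nonneg_nonneg[of e' "1 - 2 * e'"] e' by (simp add: algebra_simps)
  also have "\<dots> \<le> (1 - e') * (1 + e)" using e' by (intro mult_left_mono) auto
  finally have ee: "1 + e' \<le> (1 - e') * (1 + e)" .
  obtain n where n: "n > 0"
    "\<And>z c d. 0 \<le> c * d \<Longrightarrow> \<bar>h (z + d) - h z\<bar> \<le> n * \<bar>h (z + c) - h z\<bar> \<Longrightarrow>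
       \<bar>g (z + d) - g z\<bar> \<le> e' * \<bar>g (z + c) - g z\<bar>"
    using small_increment_transfer[OF assms(1,2) Mg Mh e'(1)] by metis
  obtain rg where rg: "rg > 0"
    "\<And>x t. \<bar>t\<bar> < rg \<Longrightarrow> \<bar>g (x + t) - g x\<bar> \<le> (1 + e') * \<bar>g x - g (x - t)\<bar>"
    using Sg[OF e'(1)] by blast
  obtain rh where rh: "rh > 0"
    "\<And>x t. \<bar>t\<bar> < rh \<Longrightarrow> \<bar>h (x + t) - h x\<bar> \<le> (1 + n) * \<bar>h x - h (x - t)\<bar>"
    using Sh[OF n(1)] by blast
  show thesis
  proof (rule that[of "min rg rh"])
    show "min rg rh > 0" using rg(1) rh(1) by simp
  next
    fix x a b :: real
    assume sgn: "0 \<le> a * b" and b: "\<bar>b\<bar> < min rg rh"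
      and eq: "\<bar>h (x + a) - h x\<bar> = \<bar>h x - h (x - b)\<bar>"
    have gb: "\<bar>g (x + b) - g x\<bar> \<le> (1 + e') * \<bar>g x - g (x - b)\<bar>" using b rg(2) by simp
    have "(1 - e') * \<bar>g (x + a) - g x\<bar> \<le> \<bar>g (x + b) - g x\<bar>"
    proof (cases "0 \<le> a \<and> a \<le> b \<or> b \<le> a \<and> a \<le> 0")
      case True
      have "(1 - e') * \<bar>g (x + a) - g x\<bar> \<le> 1 * \<bar>g (x + a) - g x\<bar>"
        using e'(1) by (intro mult_right_mono) auto
      also have "\<dots> \<le> \<bar>g (x + b) - g x\<bar>"
        using increment_mono[OF mono(1) True, of x] by simp
      finally show ?thesis .
    next
      case False
      then have ba: "0 \<le> b \<and> b \<le> a \<or> a \<le> b \<and> b \<le> 0"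
        using sgn by (auto simp: zero_le_mult_iff)
      have "\<bar>h (x + a) - h x\<bar> \<le> (1 + n) * \<bar>h (x + b) - h x\<bar>"
        \<comment> \<open>The step \<open>- b\<close> bounds the \<open>h\<close>-increment on
          \<open>[x - b, x]\<close> by that on \<open>[x, x + b]\<close>, and \<open>eq\<close>
          replaces the former by the increment over \<open>a\<close>.\<close>
        using rh(2)[of "- b" x] b eq by (simp add: abs_minus_commute)
      then have "\<bar>h (x + a) - h (x + b)\<bar> \<le> n * \<bar>h (x + b) - h x\<bar>"
        using increment_split[OF mono(2) ba, of x] by (simp add: algebra_simps)
      also have "\<dots> \<le> n * \<bar>h (x + a) - h x\<bar>"
        using n(1) increment_mono[OF mono(2) ba, of x] by (intro mult_left_mono) auto
      \<comment> \<open>The excess between \<open>x + b\<close> and \<open>x + a\<close> shares with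
        the whole interval the endpoint \<open>x + a\<close>, so the transfer is applied there with
        \<open>c = - a\<close> and \<open>d = b - a\<close>.\<close>
      finally have "\<bar>h ((x + a) + (b - a)) - h (x + a)\<bar> \<le> n * \<bar>h ((x + a) + (- a)) - h (x + a)\<bar>"
        by (simp add: abs_minus_commute)
      moreover have "0 \<le> (- a) * (b - a)"
        using ba by (auto simp: mult_le_0_iff zero_le_mult_iff)
      ultimately have
        "\<bar>g ((x + a) + (b - a)) - g (x + a)\<bar> \<le> e' * \<bar>g ((x + a) + (- a)) - g (x + a)\<bar>"
        using n(2) by blast
      then have "\<bar>g (x + a) - g (x + b)\<bar> \<le> e' * \<bar>g (x + a) - g x\<bar>"
        by (simp add: abs_minus_commute)
      then show ?thesis
        using increment_split[OF mono(1) ba, of x] by (simp add: algebra_simps)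
    qed
    also note gb
    also have "(1 + e') * \<bar>g x - g (x - b)\<bar> \<le> (1 - e') * (1 + e) * \<bar>g x - g (x - b)\<bar>"
      using ee by (intro mult_right_mono) auto
    finally have "(1 - e') * \<bar>g (x + a) - g x\<bar> \<le> (1 - e') * ((1 + e) * \<bar>g x - g (x - b)\<bar>)"
      by (simp add: mult.assoc)
    then show "\<bar>g (x + a) - g x\<bar> \<le> (1 + e) * \<bar>g x - g (x - b)\<bar>"
      using e' by simp
  qed
qed

section \<open>Passage to the composition by substituting preimages under \<open>h\<close>\<close>

theorem theorem11:
  fixes g h :: "real \<Rightarrow> real"
  assumes "g \<in> symmetric_homeos"
    and "h \<in> symmetric_homeos"
    and "uniformly_continuous_on UNIV (inv h)"
  shows "g \<circ> inv h \<in> symmetric_homeos"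
proof -
  from assms(1) obtain Mg kg where g: "strict_mono g" "homeomorphism UNIV UNIV g kg"
    and Mg: "Mg \<ge> 1" "\<And>x t. \<bar>g (x + t) - g x\<bar> \<le> Mg * \<bar>g x - g (x - t)\<bar>"
    and Sg: "\<And>e. e > 0 \<Longrightarrow>
      \<exists>d>0. \<forall>x t. \<bar>t\<bar> < d \<longrightarrow> \<bar>g (x + t) - g x\<bar> \<le> (1 + e) * \<bar>g x - g (x - t)\<bar>"
    unfolding symmetric_homeos_iff increasing_homeo_def by blast
  from assms(2) obtain Mh k where h: "strict_mono h" "homeomorphism UNIV UNIV h k"
    and Mh: "Mh \<ge> 1" "\<And>x t. \<bar>h (x + t) - h x\<bar> \<le> Mh * \<bar>h x - h (x - t)\<bar>"
    and Sh: "\<And>e. e > 0 \<Longrightarrow>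
      \<exists>d>0. \<forall>x t. \<bar>t\<bar> < d \<longrightarrow> \<bar>h (x + t) - h x\<bar> \<le> (1 + e) * \<bar>h x - h (x - t)\<bar>"
    unfolding symmetric_homeos_iff increasing_homeo_def by blast
  have hk: "h (k y) = y" and kh: "k (h y) = y" for y
    using h(2) by (auto simp: homeomorphism_def)
  have inv: "inv h = k" using hk kh by (intro inv_equality) auto
  have k: "strict_mono k"
    unfolding strict_mono_def using strict_mono_less[OF h(1)] hk by metis
  have homeo: "increasing_homeo (g \<circ> k)"
    unfolding increasing_homeo_def
    using strict_mono_o[OF g(1) k] homeomorphism_compose[OF homeomorphism_symD[OF h(2)] g(2)] by blast
  \<comment> \<open>Here \<open>a = k (y + t) - k y\<close> and \<open>b = k y - k (y - t)\<close>
    at the base point \<open>k y\<close>. Both have the sign of \<open>t\<close>, and both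
    \<open>h\<close>-increments equal \<open>t\<close> in absolute value.\<close>
  have sgn: "0 \<le> (k (y + t) - k y) * (k y - k (y - t))" for y t
    using strict_mono_less_eq[OF k, of "y + t" y] strict_mono_less_eq[OF k, of y "y - t"]
      strict_mono_less_eq[OF k, of "y - t" y] strict_mono_less_eq[OF k, of y "y + t"]
    by (cases "t \<ge> 0") (auto simp: zero_le_mult_iff)
  have eq: "\<bar>h (k y + (k (y + t) - k y)) - h (k y)\<bar> =
      \<bar>h (k y) - h (k y - (k y - k (y - t)))\<bar>" for y t
    by (simp add: hk)
  have qs: "\<exists>M\<ge>1. \<forall>y t. \<bar>(g \<circ> k) (y + t) - (g \<circ> k) y\<bar> \<le> M * \<bar>(g \<circ> k) y - (g \<circ> k) (y - t)\<bar>"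
  proof -
    obtain M where M: "M \<ge> 1"
      "\<And>x a b. 0 \<le> a * b \<Longrightarrow> \<bar>h (x + a) - h x\<bar> = \<bar>h x - h (x - b)\<bar> \<Longrightarrow>
         \<bar>g (x + a) - g x\<bar> \<le> M * \<bar>g x - g (x - b)\<bar>"
      using increment_comparison[OF g(1) h(1) Mg Mh] by metis
    show ?thesis using M(1) M(2)[OF sgn eq] by auto
  qed
  have sym: "\<exists>d>0. \<forall>y t. \<bar>t\<bar> < d \<longrightarrow>
      \<bar>(g \<circ> k) (y + t) - (g \<circ> k) y\<bar> \<le> (1 + e) * \<bar>(g \<circ> k) y - (g \<circ> k) (y - t)\<bar>" if e: "e > 0" for e
  proof -
    obtain r where r: "r > 0"
      "\<And>x a b. 0 \<le> a * b \<Longrightarrow> \<bar>b\<bar> < r \<Longrightarrow> \<bar>h (x + a) - h x\<bar> = \<bar>h x - h (x - b)\<bar> \<Longrightarrow>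
         \<bar>g (x + a) - g x\<bar> \<le> (1 + e) * \<bar>g x - g (x - b)\<bar>"
      using increment_comparison_small_scale[OF g(1) h(1) Mg Mh Sg Sh e] by metis
    obtain d where d: "d > 0" "\<And>y y'. \<bar>y' - y\<bar> < d \<Longrightarrow> \<bar>k y' - k y\<bar> < r"
      using assms(3) r(1) unfolding inv uniformly_continuous_on_def dist_real_def by (metis UNIV_I)
    have "\<bar>k y - k (y - t)\<bar> < r" if "\<bar>t\<bar> < d" for y t
      using d(2)[of y "y - t"] that by simp
    \<comment> \<open>The open premise of \<open>r(2)\<close> is the bound on \<open>b\<close>,
      which holds for all \<open>y\<close> with the same \<open>d\<close>.\<close>
    then show ?thesis using d(1) r(2)[OF sgn _ eq] by auto
  qed
  show ?thesis unfolding inv symmetric_homeos_iff using homeo qs sym by blast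
qed

end
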